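(* Let $\mathcal E(t,x)$, $\rho(t,x,\lambda)$, $\mathcal N(t,x,\lambda)$ be a solution of the initial-boundary value problem for the Maxwell--Bloch equations $$\mathcal E_t+\mathcal E_x=\int_{-\infty}^{\infty}n(s)\rho(t,x,s)\,ds,\qquad \rho_t+2i\lambda\rho=\mathcal N\mathcal E,\qquad \mathcal N_t=-\tfrac12\big(\overline{\mathcal E}\rho+\mathcal E\overline{\rho}\big),$$ $t\in(0,\infty)$, $x\in(0,L)$, $L\le\infty$, $\lambda\in\mathbb R$, with initial conditions $\mathcal E(0,x)=0$, $\rho(0,x,\lambda)=0$, $\mathcal N(0,x,\lambda)=-1$ and boundary condition $\mathcal E(t,0)=A_0e^{i\omega_0t}$. Then for $t\le x$ and $t,x\ge0$ the solution is trivial, i.e. $\mathcal E(t,x)\equiv0$, $\rho(t,x,\lambda)\equiv0$ and $\mathcal N(t,x,\lambda)\equiv-1$.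
   Context: $\mathcal E,\rho$ are complex valued, $\mathcal N$ is real valued, with the normalization $\mathcal N^2+|\rho|^2\equiv1$; $A_0,\omega_0>0$ are constants. It is assumed that $\mathcal E(t,x)$ and its partial derivatives in $t$, $x$ are bounded in the vicinity of $(0,0)$. Assumptions on $n$. $n(\lambda)\ge0$ and $\int_{-\infty}^\infty n(\lambda)\,d\lambda=1$. A number $0<\Lambda\le+\infty$ is fixed and one of the following holds. (1) $\Lambda=+\infty$: $n$ satisfies the Hölder condition on $\mathbb R$ and in a neighborhood of infinity (i.e. $|n(\zeta_1)-n(\zeta_2)|\le C|\zeta_1^{-1}-\zeta_2^{-1}|^{\mu}$ for sufficiently large $|\zeta_1|,|\zeta_2|$, with constants $C>0$, $0<\mu\le1$), and $n(\pm\infty)=0$. (2) $\Lambda<\infty$: $n$ has compact support $[-\Lambda,\Lambda]$, $n(\pm\Lambda)=0$, and either $n$ satisfies the Hölder condition on $[-\Lambda,\Lambda]$, or $n(\lambda)=\frac1{2\Lambda}$ for $|\lambda|<\Lambda$ and $n(\lambda)=0$ for $|\lambda|\ge\Lambda$. *)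

theory Defs
  imports "HOL-Analysis.Analysis"
begin

definition holder_on :: "real set \<Rightarrow> (real \<Rightarrow> real) \<Rightarrow> bool" where
  "holder_on S f \<longleftrightarrow> (\<exists>C>0. \<exists>\<mu>. 0 < \<mu> \<and> \<mu> \<le> 1 \<and>
     (\<forall>a\<in>S. \<forall>b\<in>S. \<bar>f a - f b\<bar> \<le> C * \<bar>a - b\<bar> powr \<mu>))"

definition holder_near_infinity :: "(real \<Rightarrow> real) \<Rightarrow> bool" where
  "holder_near_infinity f \<longleftrightarrow> (\<exists>C>0. \<exists>\<mu>. 0 < \<mu> \<and> \<mu> \<le> 1 \<and>
     (\<exists>R>0. \<forall>a b. \<bar>a\<bar> > R \<longrightarrow> \<bar>b\<bar> > R \<longrightarrow>
        \<bar>f a - f b\<bar> \<le> C * \<bar>inverse a - inverse b\<bar> powr \<mu>))"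

definition broadening_density :: "ereal \<Rightarrow> (real \<Rightarrow> real) \<Rightarrow> bool" where
  "broadening_density \<Lambda> n \<longleftrightarrow>
     0 < \<Lambda> \<and> (\<forall>s. 0 \<le> n s) \<and> has_bochner_integral lebesgue n 1 \<and>
     ((\<Lambda> = \<infinity> \<and> holder_on UNIV n \<and> holder_near_infinity n \<and>
         (n \<longlongrightarrow> 0) at_top \<and> (n \<longlongrightarrow> 0) at_bot) \<or>
      (\<exists>l. \<Lambda> = ereal l \<and> closure {s. n s \<noteq> 0} = {-l..l} \<and> n l = 0 \<and> n (-l) = 0 \<and>
         (holder_on {-l..l} n \<or> (\<forall>s. n s = (if \<bar>s\<bar> < l then 1 / (2 * l) else 0)))))"

definition partial_t :: "(real \<Rightarrow> real \<Rightarrow> complex) \<Rightarrow> real \<Rightarrow> real \<Rightarrow> complex" where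
  "partial_t f t x = vector_derivative (\<lambda>\<tau>. f \<tau> x) (at t)"

definition partial_x :: "(real \<Rightarrow> real \<Rightarrow> complex) \<Rightarrow> real \<Rightarrow> real \<Rightarrow> complex" where
  "partial_x f t x = vector_derivative (\<lambda>y. f t y) (at x)"

text \<open>
  The data \<open>E 0 x = 0\<close> and \<open>E t 0 = A0 * cis (\<omega>0 * t)\<close> with \<open>A0 > 0\<close> are incompatible at the
  corner \<open>(0, 0)\<close>, so \<open>E\<close> necessarily jumps across the characteristic \<open>t = x\<close> issuing from it. A
  solution is therefore required to satisfy the equations classically only where \<open>t \<noteq> x\<close>, to be
  continuous up to the axes (corner excluded) on either side of that line, and to take on the line
  itself its limit from the side \<open>t < x\<close>. The functions \<open>\<rho>\<close> and \<open>N\<close> stay continuous in \<open>t\<close>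
  across the line. Every function solving the equations classically at all \<open>t > 0\<close>, \<open>0 < x < L\<close>,
  continuously up to the axes, is a solution in this sense.
\<close>

definition maxwell_bloch_solution ::
  "(real \<Rightarrow> real) \<Rightarrow> ereal \<Rightarrow> (real \<Rightarrow> real \<Rightarrow> complex) \<Rightarrow> (real \<Rightarrow> real \<Rightarrow> real \<Rightarrow> complex) \<Rightarrow>
   (real \<Rightarrow> real \<Rightarrow> real \<Rightarrow> real) \<Rightarrow> bool" where
  "maxwell_bloch_solution n L E \<rho> N \<longleftrightarrow>
     continuous_on {(t, x). 0 \<le> t \<and> t \<le> x \<and> 0 < x \<and> ereal x < L} (\<lambda>(t, x). E t x) \<and>
     continuous_on {(t, x). 0 \<le> x \<and> x < t \<and> ereal x < L} (\<lambda>(t, x). E t x) \<and>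
     (\<forall>x \<xi>. 0 < x \<longrightarrow> ereal x < L \<longrightarrow>
        continuous_on {0..} (\<lambda>t. \<rho> t x \<xi>) \<and> continuous_on {0..} (\<lambda>t. N t x \<xi>)) \<and>
     (\<forall>t x. 0 < t \<longrightarrow> 0 < x \<longrightarrow> ereal x < L \<longrightarrow> t \<noteq> x \<longrightarrow>
        (\<lambda>(\<tau>, y). E \<tau> y) differentiable (at (t, x)) \<and>
        integrable lebesgue (\<lambda>s. complex_of_real (n s) * \<rho> t x s) \<and>
        partial_t E t x + partial_x E t x =
          (\<integral>s. complex_of_real (n s) * \<rho> t x s \<partial>lebesgue) \<and>
        (\<forall>\<xi>.
          (\<lambda>\<tau>. \<rho> \<tau> x \<xi>) differentiable (at t) \<and>
          vector_derivative (\<lambda>\<tau>. \<rho> \<tau> x \<xi>) (at t) + 2 * \<i> * complex_of_real \<xi> * \<rho> t x \<xi> =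
            complex_of_real (N t x \<xi>) * E t x \<and>
          (\<lambda>\<tau>. N \<tau> x \<xi>) differentiable (at t) \<and>
          complex_of_real (vector_derivative (\<lambda>\<tau>. N \<tau> x \<xi>) (at t)) =
            - (1 / 2) * (cnj (E t x) * \<rho> t x \<xi> + E t x * cnj (\<rho> t x \<xi>))))"

definition bounded_near_corner :: "ereal \<Rightarrow> (real \<Rightarrow> real \<Rightarrow> complex) \<Rightarrow> bool" where
  "bounded_near_corner L E \<longleftrightarrow> (\<exists>\<delta>>0. \<exists>M. \<forall>t x.
     0 < t \<longrightarrow> t < \<delta> \<longrightarrow> 0 < x \<longrightarrow> x < \<delta> \<longrightarrow> ereal x < L \<longrightarrow> t \<noteq> x \<longrightarrow>
       cmod (E t x) \<le> M \<and> cmod (partial_t E t x) \<le> M \<and> cmod (partial_x E t x) \<le> M)"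

end

theory Submission
  imports Defs
begin

text \<open>
  Below the characteristic \<open>t = x\<close> the solution is determined by the initial data at \<open>t = 0\<close> alone,
  and the trivial state solves that Cauchy problem; the statement is thus a uniqueness result.
  Two first order equations are integrated in turn. The factor \<open>exp (2 * \<i> * \<xi> * t)\<close> is unimodular
  and \<open>\<bar>N\<bar> \<le> 1\<close> by the normalization, so \<open>\<rho>\<close> is at most the integral of \<open>\<bar>E\<bar>\<close> in \<open>t\<close> at fixed
  \<open>x\<close> (\<open>polarization_bound\<close>). As \<open>n\<close> has total mass one, \<open>E\<close> is in turn at most the integral of
  such a bound along the characteristic \<open>x - t = const\<close> (\<open>characteristic_derivative\<close>).

  Both integrations stay inside a triangle \<open>0 \<le> t\<close>, \<open>c + t \<le> x \<le> b\<close> with \<open>c > 0\<close>, which is compact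
  and avoids the corner, so that \<open>E\<close> is continuous on it. Let \<open>m\<close> be the maximum of
  \<open>\<bar>E\<bar> * exp (- 2 * t)\<close> there. Each integration of \<open>exp (2 * t)\<close> gains a factor \<open>1 / 2\<close>, hence
  \<open>m \<le> m / 4\<close> and \<open>E = 0\<close> (\<open>field_vanishes_below_diagonal\<close>). With \<open>E = 0\<close> the Bloch equations keep
  \<open>\<rho>\<close> and \<open>N\<close> at their initial values, and the line \<open>t = x\<close> is reached by continuity.
\<close>

section \<open>Integral bounds for the two equations\<close>

text \<open>
  The function \<open>exp (2 * \<i> * \<xi> * t) * r t\<close> has the same modulus as \<open>r\<close>, and its derivative has the
  modulus of the forcing \<open>g\<close>: the oscillation drops out, and the bound is uniform in \<open>\<xi>\<close>.
\<close>

lemma polarization_bound: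
  fixes r g :: "real \<Rightarrow> complex" and \<phi> \<phi>' :: "real \<Rightarrow> real" and \<xi> t :: real
  assumes "0 < t"
    and cont: "continuous_on {0..t} r" "continuous_on {0..t} \<phi>"
    and "r 0 = 0"
    and r': "\<And>s. 0 < s \<Longrightarrow> s < t \<Longrightarrow>
      (r has_vector_derivative (g s - 2 * \<i> * complex_of_real \<xi> * r s)) (at s)"
    and \<phi>': "\<And>s. 0 < s \<Longrightarrow> s < t \<Longrightarrow> (\<phi> has_vector_derivative \<phi>' s) (at s)"
    and g: "\<And>s. 0 < s \<Longrightarrow> s < t \<Longrightarrow> cmod (g s) \<le> \<phi>' s"
  shows "cmod (r t) \<le> \<phi> t - \<phi> 0"
proof -
  define e where "e s = exp (s *\<^sub>R (2 * \<i> * complex_of_real \<xi>))" for s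
  have norm_e: "cmod (e s) = 1" for s
    unfolding e_def by (simp add: norm_exp_eq_Re)
  have e': "(e has_vector_derivative (2 * \<i> * complex_of_real \<xi> * e s)) (at s)" for s
    using exp_scaleR_has_vector_derivative_right[of "2 * \<i> * complex_of_real \<xi>" s UNIV]
    unfolding e_def by (simp add: mult.commute)
  have "cmod (e t * r t - e 0 * r 0) \<le> \<phi> t - \<phi> 0"
  proof (rule differentiable_bound_general[OF \<open>0 < t\<close>, where f' = "\<lambda>s. e s * g s" and \<phi>' = \<phi>'])
    show "continuous_on {0..t} (\<lambda>s. e s * r s)"
      unfolding e_def by (intro continuous_intros cont)
    show "((\<lambda>s. e s * r s) has_vector_derivative e s * g s) (at s)" if "0 < s" "s < t" for s
      by (rule has_vector_derivative_eq_rhs[OF has_vector_derivative_mult[OF e' r'[OF that]]])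
        (simp add: algebra_simps)
  qed (use assms norm_e in \<open>auto simp: norm_mult\<close>)
  then show ?thesis
    using \<open>r 0 = 0\<close> norm_e by (simp add: norm_mult)
qed

text \<open>
  Joint differentiability makes the operator \<open>\<partial>\<^sub>t + \<partial>\<^sub>x\<close> the derivative in the direction \<open>(1, 1)\<close>.
\<close>

lemma characteristic_derivative:
  fixes f :: "real \<Rightarrow> real \<Rightarrow> complex"
  assumes "(\<lambda>(\<tau>, y). f \<tau> y) differentiable (at (s, d + s))"
  shows "((\<lambda>s. f s (d + s)) has_vector_derivative
           (partial_t f s (d + s) + partial_x f s (d + s))) (at s)"
proof -
  obtain D where D: "((\<lambda>(\<tau>, y). f \<tau> y) has_derivative D) (at (s, d + s))"
    using assms unfolding differentiable_def by blast
  then interpret D: bounded_linear D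
    by (rule has_derivative_bounded_linear)
  have along: "((\<lambda>z. f (p z) (q z)) has_vector_derivative D (u, v)) (at z)"
    if "p z = s" "q z = d + s" "(p has_vector_derivative u) (at z)" "(q has_vector_derivative v) (at z)"
    for p q :: "real \<Rightarrow> real" and u v z
  proof -
    have "((\<lambda>z. (p z, q z)) has_vector_derivative (u, v)) (at z)"
      using that(3,4) by (rule has_vector_derivative_Pair)
    then show ?thesis
      using has_derivative_compose[of "\<lambda>z. (p z, q z)" "\<lambda>h. h *\<^sub>R (u, v)" z UNIV
          "\<lambda>(\<tau>, y). f \<tau> y" D] D that(1,2)
      unfolding has_vector_derivative_def D.scaleR by simp
  qed
  have "((\<lambda>\<tau>. f \<tau> (d + s)) has_vector_derivative D (1, 0)) (at s)"
    by (rule along) (auto intro!: derivative_eq_intros)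
  moreover have "((\<lambda>y. f s y) has_vector_derivative D (0, 1)) (at (d + s))"
    by (rule along) (auto intro!: derivative_eq_intros)
  moreover have "((\<lambda>s. f s (d + s)) has_vector_derivative D (1, 1)) (at s)"
    by (rule along) (auto intro!: derivative_eq_intros)
  moreover have "D (1, 1) = D (1, 0) + D (0, 1)"
    using D.add[of "(1, 0)" "(0, 1)"] by simp
  ultimately show ?thesis
    unfolding partial_t_def partial_x_def by (simp add: vector_derivative_at)
qed

lemma density_weighted_bound:
  fixes n :: "real \<Rightarrow> real" and h :: "real \<Rightarrow> complex"
  assumes "\<And>s. 0 \<le> n s" and "has_bochner_integral lebesgue n 1"
    and "integrable lebesgue (\<lambda>s. complex_of_real (n s) * h s)"
    and "\<And>s. cmod (h s) \<le> B"
  shows "cmod (\<integral>s. complex_of_real (n s) * h s \<partial>lebesgue) \<le> B"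
proof -
  have "cmod (\<integral>s. complex_of_real (n s) * h s \<partial>lebesgue) \<le> (\<integral>s. n s * B \<partial>lebesgue)"
  proof (rule Bochner_Integration.integral_norm_bound_integral)
    show "integrable lebesgue (\<lambda>s. n s * B)"
      using assms(2) by (simp add: has_bochner_integral_iff)
    show "cmod (complex_of_real (n s) * h s) \<le> n s * B" for s
      using assms(1,4) by (simp add: norm_mult mult_left_mono)
  qed (fact assms(3))
  also have "\<dots> = B"
    using assms(2) by (simp add: has_bochner_integral_iff)
  finally show ?thesis .
qed


section \<open>Uniqueness for the field ahead of the characteristic\<close>

lemma compact_characteristic_triangle:
  "compact {(t, x). 0 \<le> t \<and> c + t \<le> x \<and> x \<le> (b::real)}"
proof -
  have "closed ({p. 0 \<le> fst p} \<inter> {p. c + fst p \<le> snd p} \<inter> {p. snd p \<le> b})"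
    by (intro closed_Int closed_Collect_le continuous_intros)
  moreover have "bounded ({p. 0 \<le> fst p} \<inter> {p. c + fst p \<le> snd p} \<inter> {p. snd p \<le> b})"
    by (rule bounded_subset[OF bounded_cbox[of "(0, c)" "(b - c, b)"]]) auto
  moreover have "{(t, x). 0 \<le> t \<and> c + t \<le> x \<and> x \<le> b}
      = {p. 0 \<le> fst p} \<inter> {p. c + fst p \<le> snd p} \<inter> {p. snd p \<le> b}"
    by auto
  ultimately show ?thesis
    by (simp add: compact_eq_bounded_closed)
qed

lemma maxwell_bloch_polarization_derivative:
  assumes "maxwell_bloch_solution n L E \<rho> N" "0 < t" "0 < x" "ereal x < L" "t \<noteq> x"
  shows "((\<lambda>\<tau>. \<rho> \<tau> x \<xi>) has_vector_derivative
      (complex_of_real (N t x \<xi>) * E t x - 2 * \<i> * complex_of_real \<xi> * \<rho> t x \<xi>)) (at t)"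
proof -
  have "(\<lambda>\<tau>. \<rho> \<tau> x \<xi>) differentiable (at t)"
    and "vector_derivative (\<lambda>\<tau>. \<rho> \<tau> x \<xi>) (at t) + 2 * \<i> * complex_of_real \<xi> * \<rho> t x \<xi>
      = complex_of_real (N t x \<xi>) * E t x"
    using assms unfolding maxwell_bloch_solution_def by blast+
  then show ?thesis
    by (metis vector_derivative_works eq_diff_eq)
qed

text \<open>
  The triangle \<open>K\<close> contains every point that influences \<open>E t x\<close>: from any of its points, following
  the characteristic or the line of constant \<open>x\<close> back to time zero does not leave it. It is bounded
  by the characteristic through \<open>(t, x)\<close>, by the line of constant \<open>x\<close> and by the initial line.
\<close>

lemma field_vanishes_below_diagonal:
  assumes dens: "\<And>s. 0 \<le> n s" "has_bochner_integral lebesgue n 1"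
    and sol: "maxwell_bloch_solution n L E \<rho> N"
    and normalized: "\<And>t x \<xi>. 0 < t \<Longrightarrow> 0 < x \<Longrightarrow> ereal x < L \<Longrightarrow>
      (N t x \<xi>)\<^sup>2 + (cmod (\<rho> t x \<xi>))\<^sup>2 = 1"
    and E0: "\<And>x. 0 \<le> x \<Longrightarrow> ereal x < L \<Longrightarrow> E 0 x = 0"
    and \<rho>0: "\<And>x \<xi>. 0 \<le> x \<Longrightarrow> ereal x < L \<Longrightarrow> \<rho> 0 x \<xi> = 0"
    and tx: "0 \<le> t" "t < x" "ereal x < L"
  shows "E t x = 0"
proof -
  define c where "c = x - t"
  define K where "K = {(\<tau>, y). 0 \<le> \<tau> \<and> c + \<tau> \<le> y \<and> y \<le> x}"
  have "0 < c"
    using tx by (simp add: c_def)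
  have below_L: "ereal y < L" if "y \<le> x" for y
    by (rule le_less_trans[OF _ tx(3)]) (use that in simp)
  have contE: "continuous_on {(t, x). 0 \<le> t \<and> t \<le> x \<and> 0 < x \<and> ereal x < L} (\<lambda>(t, x). E t x)"
    using sol unfolding maxwell_bloch_solution_def by blast
  have contK: "continuous_on K (\<lambda>(t, x). E t x)"
    using contE by (rule continuous_on_subset) (use \<open>0 < c\<close> below_L in \<open>auto simp: K_def\<close>)
  have "compact K"
    unfolding K_def by (rule compact_characteristic_triangle)
  moreover have "(t, x) \<in> K"
    using tx by (auto simp: K_def c_def)
  moreover have "continuous_on K (\<lambda>p. cmod (case p of (t, x) \<Rightarrow> E t x) * exp (- 2 * fst p))"
    by (intro continuous_intros contK)
  ultimately have "\<exists>p\<in>K. \<forall>q\<in>K. cmod (case q of (t, x) \<Rightarrow> E t x) * exp (- 2 * fst q)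
      \<le> cmod (case p of (t, x) \<Rightarrow> E t x) * exp (- 2 * fst p)"
    by (intro continuous_attains_sup) blast+
  then obtain p where p: "p \<in> K"
    "\<And>q. q \<in> K \<Longrightarrow> cmod (case q of (t, x) \<Rightarrow> E t x) * exp (- 2 * fst q)
      \<le> cmod (case p of (t, x) \<Rightarrow> E t x) * exp (- 2 * fst p)"
    by blast
  obtain t1 x1 where p_eq: "p = (t1, x1)"
    by (rule prod.exhaust)
  have max_in: "(t1, x1) \<in> K"
    using p(1) by (simp add: p_eq)
  have max: "cmod (E \<tau> y) * exp (- 2 * \<tau>) \<le> cmod (E t1 x1) * exp (- 2 * t1)" if "(\<tau>, y) \<in> K" for \<tau> y
    using p(2)[OF that] by (simp add: p_eq)
  define m where "m = cmod (E t1 x1) * exp (- 2 * t1)"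
  have "0 \<le> m"
    by (simp add: m_def)
  have E_le: "cmod (E \<tau> y) \<le> m * exp (2 * \<tau>)" if "(\<tau>, y) \<in> K" for \<tau> y
    using max[OF that] unfolding m_def[symmetric] by (simp add: exp_minus field_simps)

  have \<rho>_le: "cmod (\<rho> \<tau> y \<xi>) \<le> m / 2 * exp (2 * \<tau>)" if "(\<tau>, y) \<in> K" "0 < \<tau>" for \<tau> y \<xi>
  proof -
    have y: "0 < y" "\<tau> < y" "ereal y < L" "c + \<tau> \<le> y" "y \<le> x"
      using that \<open>0 < c\<close> below_L by (auto simp: K_def)
    have "cmod (\<rho> \<tau> y \<xi>) \<le> m / 2 * exp (2 * \<tau>) - m / 2 * exp (2 * 0)"
    proof (rule polarization_bound[OF \<open>0 < \<tau>\<close>, where r = "\<lambda>\<tau>. \<rho> \<tau> y \<xi>" and \<phi>' = "\<lambda>s. m * exp (2 * s)"])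
      have "continuous_on {0..} (\<lambda>\<tau>. \<rho> \<tau> y \<xi>)"
        using sol y unfolding maxwell_bloch_solution_def by blast
      then show "continuous_on {0..\<tau>} (\<lambda>\<tau>. \<rho> \<tau> y \<xi>)"
        by (rule continuous_on_subset) auto
      show "continuous_on {0..\<tau>} (\<lambda>s. m / 2 * exp (2 * s))"
        by (intro continuous_intros)
      show "\<rho> 0 y \<xi> = 0"
        using \<rho>0 y by simp
    next
      fix s assume s: "0 < s" "s < \<tau>"
      show "((\<lambda>\<tau>. \<rho> \<tau> y \<xi>) has_vector_derivative
          (complex_of_real (N s y \<xi>) * E s y - 2 * \<i> * complex_of_real \<xi> * \<rho> s y \<xi>)) (at s)"
        using maxwell_bloch_polarization_derivative[OF sol] s y by simp
      show "((\<lambda>s. m / 2 * exp (2 * s)) has_vector_derivative m * exp (2 * s)) (at s)"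
        unfolding has_real_derivative_iff_has_vector_derivative[symmetric]
        by (auto intro!: derivative_eq_intros)
      have "(N s y \<xi>)\<^sup>2 \<le> 1"
        using normalized[of s y \<xi>] s y zero_le_power2[of "cmod (\<rho> s y \<xi>)"] by linarith
      then have "\<bar>N s y \<xi>\<bar> \<le> 1"
        by (simp add: abs_square_le_1)
      moreover have "cmod (E s y) \<le> m * exp (2 * s)"
        using s y by (intro E_le) (auto simp: K_def)
      ultimately show "cmod (complex_of_real (N s y \<xi>) * E s y) \<le> m * exp (2 * s)"
        using mult_mono[of "\<bar>N s y \<xi>\<bar>" 1 "cmod (E s y)"] by (simp add: norm_mult)
    qed
    then show ?thesis
      using \<open>0 \<le> m\<close> by simp
  qed

  \<comment> \<open>The contraction is read off at the point where the maximum is attained, by integrating along the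
    characteristic through that point.\<close>
  have "m \<le> m / 4"
  proof (cases "t1 = 0")
    case True
    then have "E t1 x1 = 0"
      using E0 max_in \<open>0 < c\<close> below_L by (auto simp: K_def)
    then show ?thesis
      by (simp add: m_def)
  next
    case False
    define d where "d = x1 - t1"
    have t1: "0 < t1" and d: "c \<le> d" "d + t1 = x1" "x1 \<le> x"
      using max_in False by (auto simp: K_def d_def)
    have in_K: "(s, d + s) \<in> K" if "0 \<le> s" "s \<le> t1" for s
      using that d by (auto simp: K_def)
    have "cmod (E t1 (d + t1) - E 0 (d + 0)) \<le> m / 4 * exp (2 * t1) - m / 4 * exp (2 * 0)"
    proof (rule differentiable_bound_general[OF t1, where \<phi>' = "\<lambda>s. m / 2 * exp (2 * s)"])
      show "continuous_on {0..t1} (\<lambda>s. m / 4 * exp (2 * s))"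
        by (intro continuous_intros)
      have "continuous_on {0..t1} (\<lambda>s. case (s, d + s) of (t, x) \<Rightarrow> E t x)"
        by (rule continuous_on_compose2[OF contK]) (auto intro!: continuous_intros in_K)
      then show "continuous_on {0..t1} (\<lambda>s. E s (d + s))"
        by simp
    next
      fix s assume s: "0 < s" "s < t1"
      have dom: "0 < d + s" "ereal (d + s) < L" "s \<noteq> d + s"
        using s d \<open>0 < c\<close> below_L[of "d + s"] by auto
      have *: "(\<lambda>(\<tau>, y). E \<tau> y) differentiable (at (s, d + s))"
        "integrable lebesgue (\<lambda>\<xi>. complex_of_real (n \<xi>) * \<rho> s (d + s) \<xi>)"
        "partial_t E s (d + s) + partial_x E s (d + s)
          = (\<integral>\<xi>. complex_of_real (n \<xi>) * \<rho> s (d + s) \<xi> \<partial>lebesgue)"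
        using sol s(1) dom unfolding maxwell_bloch_solution_def by blast+
      show "((\<lambda>s. E s (d + s)) has_vector_derivative
          (partial_t E s (d + s) + partial_x E s (d + s))) (at s)"
        by (rule characteristic_derivative) (fact *(1))
      show "((\<lambda>s. m / 4 * exp (2 * s)) has_vector_derivative m / 2 * exp (2 * s)) (at s)"
        unfolding has_real_derivative_iff_has_vector_derivative[symmetric]
        by (auto intro!: derivative_eq_intros)
      show "cmod (partial_t E s (d + s) + partial_x E s (d + s)) \<le> m / 2 * exp (2 * s)"
        unfolding *(3) using s
        by (intro density_weighted_bound dens *(2) \<rho>_le in_K) auto
    qed
    moreover have "E 0 d = 0"
      using E0 d t1 \<open>0 < c\<close> below_L[of d] by simp
    ultimately have "cmod (E t1 x1) \<le> m / 4 * exp (2 * t1)"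
      using d \<open>0 \<le> m\<close> by simp
    then show ?thesis
      by (simp add: m_def exp_minus field_simps)
  qed
  with \<open>0 \<le> m\<close> have "m = 0"
    by simp
  then show ?thesis
    using E_le[OF \<open>(t, x) \<in> K\<close>] by simp
qed

section \<open>The trivial state up to the characteristic\<close>

text \<open>
  Carries \<open>E = 0\<close> from \<open>t < x\<close> to the characteristic \<open>t = x\<close>, on which no differential equation is
  imposed.
\<close>

lemma continuous_const_up_to_endpoint:
  fixes f :: "real \<Rightarrow> 'a::t2_space"
  assumes "0 < b" "continuous_on {0..b} f" "\<And>s. 0 \<le> s \<Longrightarrow> s < b \<Longrightarrow> f s = a"
  shows "f b = a"
  by (rule continuous_constant_on_closure[of "{0..<b}" f a b])
    (use assms in auto)

theorem theorem4p2:
  fixes n :: "real \<Rightarrow> real" and \<Lambda> L :: ereal and A0 \<omega>0 :: real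
    and E :: "real \<Rightarrow> real \<Rightarrow> complex"
    and \<rho> :: "real \<Rightarrow> real \<Rightarrow> real \<Rightarrow> complex"
    and N :: "real \<Rightarrow> real \<Rightarrow> real \<Rightarrow> real"
  assumes "broadening_density \<Lambda> n"
    and "0 < L" and "0 < A0" and "0 < \<omega>0"
    and "maxwell_bloch_solution n L E \<rho> N"
    and "\<And>t x \<xi>. 0 < t \<Longrightarrow> 0 < x \<Longrightarrow> ereal x < L \<Longrightarrow> (N t x \<xi>)\<^sup>2 + (cmod (\<rho> t x \<xi>))\<^sup>2 = 1"
    and "bounded_near_corner L E"
    and "\<And>x. 0 \<le> x \<Longrightarrow> ereal x < L \<Longrightarrow> E 0 x = 0"
    and "\<And>x \<xi>. 0 \<le> x \<Longrightarrow> ereal x < L \<Longrightarrow> \<rho> 0 x \<xi> = 0"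
    and "\<And>x \<xi>. 0 \<le> x \<Longrightarrow> ereal x < L \<Longrightarrow> N 0 x \<xi> = -1"
    and "\<And>t. 0 < t \<Longrightarrow> E t 0 = complex_of_real A0 * exp (\<i> * complex_of_real (\<omega>0 * t))"
  shows "\<forall>t x. 0 \<le> t \<longrightarrow> t \<le> x \<longrightarrow> ereal x < L \<longrightarrow>
           E t x = 0 \<and> (\<forall>\<xi>. \<rho> t x \<xi> = 0 \<and> N t x \<xi> = -1)"
proof (intro allI impI)
  fix t x :: real
  assume tx: "0 \<le> t" "t \<le> x" "ereal x < L"
  have dens: "\<And>s. 0 \<le> n s" "has_bochner_integral lebesgue n 1"
    using assms(1) unfolding broadening_density_def by blast+
  note sol = assms(5)
  \<comment> \<open>Only the column at this \<open>x\<close> matters from here on: the Bloch equations are ordinary differential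
    equations in time.\<close>
  have E_below: "E s x = 0" if "0 \<le> s" "s < x" for s
    using field_vanishes_below_diagonal[OF dens sol assms(6,8,9)] that tx(3) by blast
  show "E t x = 0 \<and> (\<forall>\<xi>. \<rho> t x \<xi> = 0 \<and> N t x \<xi> = -1)"
  proof (cases "t = 0")
    case True
    then show ?thesis
      using assms(8-10) tx by simp
  next
    case False
    then have t: "0 < t" and x: "0 < x"
      using tx by auto
    have "E t x = 0"
    proof (cases "t = x")
      case True
      have contE: "continuous_on {(t, x). 0 \<le> t \<and> t \<le> x \<and> 0 < x \<and> ereal x < L} (\<lambda>(t, x). E t x)"
        using sol unfolding maxwell_bloch_solution_def by blast
      have "continuous_on {0..x} (\<lambda>s. case (s, x) of (t, x) \<Rightarrow> E t x)"
        by (rule continuous_on_compose2[OF contE]) (use x tx in \<open>auto intro!: continuous_intros\<close>)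
      then have "continuous_on {0..x} (\<lambda>s. E s x)"
        by simp
      then have "E x x = 0"
        by (rule continuous_const_up_to_endpoint[OF x]) (fact E_below)
      with True show ?thesis
        by simp
    qed (use tx E_below in auto)
    moreover have "\<rho> t x \<xi> = 0 \<and> N t x \<xi> = -1" for \<xi>
    proof -
      have "continuous_on {0..} (\<lambda>s. \<rho> s x \<xi>)" "continuous_on {0..} (\<lambda>s. N s x \<xi>)"
        using sol x tx(3) unfolding maxwell_bloch_solution_def by blast+
      then have cont: "continuous_on {0..t} (\<lambda>s. \<rho> s x \<xi>)" "continuous_on {0..t} (\<lambda>s. N s x \<xi>)"
        by (auto elim: continuous_on_subset)
      \<comment> \<open>For \<open>t = x\<close> the estimates use the equations at times before \<open>t\<close> only, and continuity at \<open>t\<close>.\<close>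
      have "cmod (\<rho> t x \<xi>) \<le> 0 - 0"
      proof (rule polarization_bound[OF t cont(1), where \<phi> = "\<lambda>_. 0" and \<phi>' = "\<lambda>_. 0"])
        show "\<rho> 0 x \<xi> = 0"
          using assms(9) x tx(3) by simp
        show "((\<lambda>s. \<rho> s x \<xi>) has_vector_derivative
            (complex_of_real (N s x \<xi>) * E s x - 2 * \<i> * complex_of_real \<xi> * \<rho> s x \<xi>)) (at s)"
          if "0 < s" "s < t" for s
          using maxwell_bloch_polarization_derivative[OF sol] that x tx by simp
      qed (use E_below tx in auto)
      moreover have "norm (N t x \<xi> - N 0 x \<xi>) \<le> 0 - 0"
      proof (rule differentiable_bound_general[OF t, where \<phi> = "\<lambda>_. 0" and \<phi>' = "\<lambda>_. 0" and f' = "\<lambda>_. 0"])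
        fix s assume s: "0 < s" "s < t"
        have "(\<lambda>\<tau>. N \<tau> x \<xi>) differentiable (at s)"
          and "complex_of_real (vector_derivative (\<lambda>\<tau>. N \<tau> x \<xi>) (at s)) =
            - (1 / 2) * (cnj (E s x) * \<rho> s x \<xi> + E s x * cnj (\<rho> s x \<xi>))"
          using sol s x tx(3) less_le_trans[OF s(2) tx(2), THEN less_imp_neq]
          unfolding maxwell_bloch_solution_def by blast+
        then show "((\<lambda>s. N s x \<xi>) has_vector_derivative 0) (at s)"
          using E_below[of s] s tx by (simp add: vector_derivative_works)
      qed (use cont in auto)
      ultimately show ?thesis
        using assms(10) x tx(3) by simp
    qed
    ultimately show ?thesis
      by blast
  qed
qed

end
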